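(* Let $n>k\geq 2$. Let $T_n$ be the rooted tree on $n^2+1$ nodes whose root $r$ has children $v_1,\dots,v_n$, and which has leaves $s_{i,j},t_{i,j}$ for $1\leq i<j\leq n$, where $s_{i,j}$ is a child of $v_i$ and $t_{i,j}$ is a child of $v_j$. Let $e_i=rv_i$, $e_{i,j}=v_is_{i,j}$, $f_{i,j}=v_jt_{i,j}$, $L_1^n=\{e_1,\dots,e_n\}$, $L_2^n=\{e_{i,j},f_{i,j}:1\leq i<j\leq n\}$, and $S_n=\{\{s_{i,j},t_{i,j}\}:1\leq i<j\leq n\}$. Then the inequality $$(n-k)\sum_{e\in L_1^n}x_e+\sum_{e\in L_2^n}x_e\geq k(n-k)+\binom{n-k}{2}$$ defines a shared facet of $\mathrm{MultC}(T_n,S_n)$.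
   Context: Given a graph $G=(V,E)$ and $S\subseteq\binom{V}{2}$, an ($S$-)multicut is a set $\delta\subseteq E$ such that for every $\{s,t\}\in S$ the nodes $s$ and $t$ lie in different components of $G-\delta$. For $F\subseteq E$, $x^F\in\mathbb{R}^E$ is its incidence vector. The multicut polytope is $\mathrm{MultC}^{\square}(G,S)=\mathrm{conv}\{x^\delta:\delta\text{ an } S\text{-multicut}\}$ and the multicut dominant is $\mathrm{MultC}(G,S)=\mathrm{MultC}^{\square}(G,S)+\mathbb{R}^E_{\geq 0}$. A facet-defining inequality of $\mathrm{MultC}(G,S)$ defines a shared facet if it is also facet-defining for $\mathrm{MultC}^{\square}(G,S)$. *)

theory Defs
  imports "HOL-Analysis.Analysis"
begin

section \<open>Multicuts\<close>

text \<open>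
  A finite simple graph is given by its node set \<open>V\<close> and its edge set \<open>E\<close>, the edges being
  two-element sets of nodes. Likewise \<open>S\<close> is a set of two-element sets of nodes.
\<close>

definition same_component :: "'v set \<Rightarrow> 'v set set \<Rightarrow> ('v \<times> 'v) set" where
  "same_component V E = {(u, w). u \<in> V \<and> w \<in> V \<and> (u, w) \<in> {(a, b). {a, b} \<in> E}\<^sup>*}"

definition components_of_graph :: "'v set \<Rightarrow> 'v set set \<Rightarrow> 'v set set" where
  "components_of_graph V E = V // same_component V E"

definition multicut :: "'v set \<Rightarrow> 'v set set \<Rightarrow> 'v set set \<Rightarrow> 'v set set \<Rightarrow> bool" where
  "multicut V E S \<delta> \<longleftrightarrow> \<delta> \<subseteq> E \<and>
     (\<forall>s t. {s, t} \<in> S \<longrightarrow>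
        (\<forall>C \<in> components_of_graph V (E - \<delta>). \<forall>D \<in> components_of_graph V (E - \<delta>).
           s \<in> C \<longrightarrow> t \<in> D \<longrightarrow> C \<noteq> D))"

text \<open>
  The node type is finite, so that the space \<open>real ^ 'v set\<close> is Euclidean. The space of real
  vectors indexed by \<open>E\<close> is its coordinate subspace of vectors vanishing outside \<open>E\<close>; all
  polyhedra below live in that subspace, and \<^const>\<open>facet_of\<close> does not depend on the
  ambient space.
\<close>

definition incidence_vector :: "'v set set \<Rightarrow> real ^ ('v::finite) set" where
  "incidence_vector F = (\<chi> e. if e \<in> F then 1 else 0)"

definition nonneg_orthant :: "'v set set \<Rightarrow> (real ^ ('v::finite) set) set" where
  "nonneg_orthant E = {y. (\<forall>e \<in> E. 0 \<le> y $ e) \<and> (\<forall>e. e \<notin> E \<longrightarrow> y $ e = 0)}"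

definition multicut_polytope ::
    "'v set \<Rightarrow> 'v set set \<Rightarrow> 'v set set \<Rightarrow> (real ^ ('v::finite) set) set" where
  "multicut_polytope V E S = convex hull {incidence_vector \<delta> |\<delta>. multicut V E S \<delta>}"

definition multicut_dominant ::
    "'v set \<Rightarrow> 'v set set \<Rightarrow> 'v set set \<Rightarrow> (real ^ ('v::finite) set) set" where
  "multicut_dominant V E S =
     {x + y |x y. x \<in> multicut_polytope V E S \<and> y \<in> nonneg_orthant E}"

text \<open>The inequality \<open>f x \<ge> b\<close>, with \<open>f\<close> a linear form, is facet-defining for \<open>P\<close>.\<close>

definition facet_defining ::
    "('a::euclidean_space \<Rightarrow> real) \<Rightarrow> real \<Rightarrow> 'a set \<Rightarrow> bool" where
  "facet_defining f b P \<longleftrightarrow>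
     linear f \<and> (\<forall>x \<in> P. f x \<ge> b) \<and> {x \<in> P. f x = b} facet_of P"

definition defines_shared_facet ::
    "(real ^ ('v::finite) set \<Rightarrow> real) \<Rightarrow> real \<Rightarrow> 'v set \<Rightarrow> 'v set set \<Rightarrow> 'v set set \<Rightarrow> bool" where
  "defines_shared_facet f b V E S \<longleftrightarrow>
     facet_defining f b (multicut_dominant V E S) \<and>
     facet_defining f b (multicut_polytope V E S)"


section \<open>The trees\<close>

definition index_pairs :: "nat \<Rightarrow> (nat \<times> nat) set" where
  "index_pairs n = {(i, j). 1 \<le> i \<and> i < j \<and> j \<le> n}"

text \<open>
  The nodes of the tree are the values \<open>r\<close>, \<open>v i\<close>, \<open>s i j\<close>, \<open>t i j\<close> at the relevant indices; the
  values of \<open>v\<close>, \<open>s\<close>, \<open>t\<close> at other indices play no role.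
\<close>

definition tree_nodes ::
    "nat \<Rightarrow> 'v \<Rightarrow> (nat \<Rightarrow> 'v) \<Rightarrow> (nat \<Rightarrow> nat \<Rightarrow> 'v) \<Rightarrow> (nat \<Rightarrow> nat \<Rightarrow> 'v) \<Rightarrow> 'v set" where
  "tree_nodes n r v s t =
     {r} \<union> v ` {1..n} \<union> (\<lambda>(i, j). s i j) ` index_pairs n \<union> (\<lambda>(i, j). t i j) ` index_pairs n"

definition distinct_nodes ::
    "nat \<Rightarrow> 'v \<Rightarrow> (nat \<Rightarrow> 'v) \<Rightarrow> (nat \<Rightarrow> nat \<Rightarrow> 'v) \<Rightarrow> (nat \<Rightarrow> nat \<Rightarrow> 'v) \<Rightarrow> bool" where
  "distinct_nodes n r v s t \<longleftrightarrow>
     inj_on v {1..n} \<and>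
     inj_on (\<lambda>(i, j). s i j) (index_pairs n) \<and>
     inj_on (\<lambda>(i, j). t i j) (index_pairs n) \<and>
     r \<notin> v ` {1..n} \<and>
     r \<notin> (\<lambda>(i, j). s i j) ` index_pairs n \<and>
     r \<notin> (\<lambda>(i, j). t i j) ` index_pairs n \<and>
     v ` {1..n} \<inter> (\<lambda>(i, j). s i j) ` index_pairs n = {} \<and>
     v ` {1..n} \<inter> (\<lambda>(i, j). t i j) ` index_pairs n = {} \<and>
     (\<lambda>(i, j). s i j) ` index_pairs n \<inter> (\<lambda>(i, j). t i j) ` index_pairs n = {}"

definition level1_edges :: "nat \<Rightarrow> 'v \<Rightarrow> (nat \<Rightarrow> 'v) \<Rightarrow> 'v set set" where
  "level1_edges n r v = {{r, v i} |i. i \<in> {1..n}}"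

definition level2_edges ::
    "nat \<Rightarrow> (nat \<Rightarrow> 'v) \<Rightarrow> (nat \<Rightarrow> nat \<Rightarrow> 'v) \<Rightarrow> (nat \<Rightarrow> nat \<Rightarrow> 'v) \<Rightarrow> 'v set set" where
  "level2_edges n v s t =
     {{v i, s i j} |i j. (i, j) \<in> index_pairs n} \<union> {{v j, t i j} |i j. (i, j) \<in> index_pairs n}"

definition tree_edges ::
    "nat \<Rightarrow> 'v \<Rightarrow> (nat \<Rightarrow> 'v) \<Rightarrow> (nat \<Rightarrow> nat \<Rightarrow> 'v) \<Rightarrow> (nat \<Rightarrow> nat \<Rightarrow> 'v) \<Rightarrow> 'v set set" where
  "tree_edges n r v s t = level1_edges n r v \<union> level2_edges n v s t"

definition terminal_pairs ::
    "nat \<Rightarrow> (nat \<Rightarrow> nat \<Rightarrow> 'v) \<Rightarrow> (nat \<Rightarrow> nat \<Rightarrow> 'v) \<Rightarrow> 'v set set" where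
  "terminal_pairs n s t = {{s i j, t i j} |i j. (i, j) \<in> index_pairs n}"

text \<open>
  The tree has \<open>n\<^sup>2 + 1\<close> nodes, and it can be realised in every node type with at least that many
  elements, so that \<^const>\<open>distinct_nodes\<close> is satisfiable for every \<open>n\<close>.
\<close>

lemma finite_index_pairs: "finite (index_pairs n)"
  by (rule finite_subset[of _ "{1..n} \<times> {1..n}"]) (auto simp: index_pairs_def)

lemma card_index_pairs: "2 * card (index_pairs n) + n = n\<^sup>2"
proof (induction n)
  case 0
  have "index_pairs 0 = {}" by (auto simp: index_pairs_def)
  then show ?case by simp
next
  case (Suc n)
  have eq: "index_pairs (Suc n) = index_pairs n \<union> {1..n} \<times> {Suc n}"
    by (auto simp: index_pairs_def)
  have "card (index_pairs (Suc n)) = card (index_pairs n) + n"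
    unfolding eq
    by (subst card_Un_disjoint) (simp_all add: finite_index_pairs, auto simp: index_pairs_def)
  then show ?case using Suc by (simp add: power2_eq_square)
qed

lemma card_tree_nodes:
  assumes "distinct_nodes n r v s t"
  shows "card (tree_nodes n r v s t) = n\<^sup>2 + 1"
proof -
  note d = assms[unfolded distinct_nodes_def]
  have "card (tree_nodes n r v s t) =
      1 + card (v ` {1..n}) + card ((\<lambda>(i, j). s i j) ` index_pairs n) +
      card ((\<lambda>(i, j). t i j) ` index_pairs n)"
    unfolding tree_nodes_def using d
    by (subst card_Un_disjoint; (simp add: finite_index_pairs Int_Un_distrib2)?)+
  also have "\<dots> = 1 + n + card (index_pairs n) + card (index_pairs n)"
    using d by (simp add: card_image)
  finally show ?thesis using card_index_pairs[of n] by simp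
qed

lemma distinct_nodes_exist:
  assumes "n\<^sup>2 + 1 \<le> CARD('v::finite)"
  shows "\<exists>(r::'v) v s t. distinct_nodes n r v s t"
proof -
  let ?L = "insert (0, 0) ({1..n} \<times> {1..n})"
  have "card ?L \<le> CARD('v)"
    using assms by (simp add: power2_eq_square)
  then obtain g :: "nat \<times> nat \<Rightarrow> 'v" where g: "inj_on g ?L"
    using card_le_inj[of ?L "UNIV :: 'v set"] by auto
  have g_eq: "g a = g b \<longleftrightarrow> a = b" if "a \<in> ?L" "b \<in> ?L" for a b
    using inj_on_eq_iff[OF g] that by blast
  have "distinct_nodes n (g (0, 0)) (\<lambda>i. g (i, i)) (\<lambda>i j. g (i, j)) (\<lambda>i j. g (j, i))"
    unfolding distinct_nodes_def inj_on_def index_pairs_def by (auto simp: g_eq)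
  then show ?thesis by blast
qed

end

theory Submission
  imports Defs
begin

text \<open>
  A multicut that leaves exactly \<open>b\<close> of the \<open>n\<close> level 1 edges uncut needs one level 2 edge for
  each of the \<open>b choose 2\<close> pairs that are not separated at level 1. The left-hand side is therefore at
  least \<open>(n - k) * (n - b) + (b choose 2)\<close>, a convex function of \<open>b\<close> whose minimum is attained exactly at
  \<open>b = n - k\<close> and \<open>b = n - k + 1\<close>. Comparing tight multicuts of these two kinds shows that their
  differences span all differences of level 2 unit vectors (here \<open>k \<ge> 2\<close> gives room for an
  exchange) and express each level 1 unit vector through level 2 ones, so together with one
  further multicut they span the whole edge space.
\<close>

section \<open>Facets and multicuts in general\<close>

text \<open>Adding one point raises the affine dimension by at most one, so the tight points
  \<open>T\<close> already have dimension at least \<open>aff_dim P - 1\<close>. A proper face has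
  dimension strictly below \<open>aff_dim P\<close>, which leaves only the facet dimension.\<close>

lemma facet_definingI:
  fixes P :: "'a::euclidean_space set"
  assumes f: "linear f" and P: "convex P" and ge: "\<And>x. x \<in> P \<Longrightarrow> f x \<ge> b"
    and T: "T \<subseteq> {x \<in> P. f x = b}" "T \<noteq> {}"
    and p: "p \<in> P" "f p \<noteq> b"
    and dim: "aff_dim P \<le> aff_dim (insert p T)"
  shows "facet_defining f b P"
proof -
  let ?F = "{x \<in> P. f x = b}"
  \<comment> \<open>\<open>adjoint f 1\<close> is the vector that represents the linear form, so
    that the results on supporting hyperplanes apply.\<close>
  have inner: "f x = adjoint f 1 \<bullet> x" for x
    using adjoint_works[OF f, of x 1] by (simp add: inner_commute)
  have "P \<inter> {x. adjoint f 1 \<bullet> x = b} face_of P"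
    using P ge by (intro face_of_Int_supporting_hyperplane_ge) (auto simp flip: inner)
  moreover have "P \<inter> {x. adjoint f 1 \<bullet> x = b} = ?F"
    by (auto simp flip: inner)
  ultimately have face: "?F face_of P"
    by simp
  have "?F \<noteq> P"
    using p by blast
  then have "aff_dim ?F < aff_dim P"
    using face P by (intro face_of_aff_dim_lt) auto
  moreover have "aff_dim (insert p T) \<le> aff_dim T + 1"
    by (simp add: aff_dim_insert)
  moreover have "aff_dim T \<le> aff_dim ?F"
    using T(1) by (rule aff_dim_subset)
  ultimately have "aff_dim ?F = aff_dim P - 1"
    using dim by linarith
  then show ?thesis
    unfolding facet_defining_def facet_of_def using f ge face T by auto
qed

text \<open>Components are the classes of the reachability equivalence on \<open>V\<close>, so lying
  in different components means not being joined by a path. A node outside \<open>V\<close> lies in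
  no component, hence the guards on \<open>a\<close> and \<open>b\<close>.\<close>

lemma multicut_iff:
  "multicut V E S \<delta> \<longleftrightarrow> \<delta> \<subseteq> E \<and>
     (\<forall>a b. {a, b} \<in> S \<longrightarrow> a \<in> V \<longrightarrow> b \<in> V \<longrightarrow> (a, b) \<notin> {(u, w). {u, w} \<in> E - \<delta>}\<^sup>*)"
proof -
  let ?adj = "{(u, w). {u, w} \<in> E - \<delta>}"
  let ?R = "same_component V (E - \<delta>)"
  have "sym ?adj"
    by (auto simp: sym_def insert_commute)
  then have "sym (?adj\<^sup>*)"
    by (rule sym_rtrancl)
  then have equiv: "equiv V ?R"
    unfolding equiv_def refl_on_def same_component_def
    by (auto simp: sym_def intro!: transI)
  have "(\<forall>C \<in> V // ?R. \<forall>D \<in> V // ?R. a \<in> C \<longrightarrow> b \<in> D \<longrightarrow> C \<noteq> D) \<longleftrightarrow>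
      (a \<in> V \<longrightarrow> b \<in> V \<longrightarrow> (a, b) \<notin> ?adj\<^sup>*)" for a b
  proof -
    have "(\<exists>C \<in> V // ?R. a \<in> C \<and> b \<in> C) \<longleftrightarrow> (a, b) \<in> ?R"
    proof
      assume "(a, b) \<in> ?R"
      moreover have "a \<in> V"
        using \<open>(a, b) \<in> ?R\<close> by (simp add: same_component_def)
      ultimately show "\<exists>C \<in> V // ?R. a \<in> C \<and> b \<in> C"
        using equiv_class_self[OF equiv] by (intro bexI[of _ "?R `` {a}"]) (auto intro: quotientI)
    qed (use equiv in \<open>auto intro: quotient_eq_iff[THEN iffD1]\<close>)
    then show ?thesis
      by (auto simp: same_component_def)
  qed
  then show ?thesis
    by (simp add: multicut_def components_of_graph_def)
qed

lemma rtrancl_closed: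
  assumes "(a, b) \<in> R\<^sup>*" "a \<in> X" "\<And>u w. (u, w) \<in> R \<Longrightarrow> u \<in> X \<Longrightarrow> w \<in> X"
  shows "b \<in> X"
  using assms(1,2) by (induction rule: rtrancl_induct) (auto intro: assms(3))

section \<open>Incidence vectors, convexity and the edge space\<close>

lemma incidence_vector_eq_sum:
  "incidence_vector F = (\<Sum>e \<in> F. axis e 1)"
  by (simp add: vec_eq_iff incidence_vector_def axis_def)

lemma convex_nonneg_orthant: "convex (nonneg_orthant E)"
  by (auto simp: convex_def nonneg_orthant_def)

lemma multicut_polytope_subset_dominant: "multicut_polytope V E S \<subseteq> multicut_dominant V E S"
proof
  fix x
  assume "x \<in> multicut_polytope V E S"
  moreover have "0 \<in> nonneg_orthant E"
    by (simp add: nonneg_orthant_def)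
  ultimately show "x \<in> multicut_dominant V E S"
    unfolding multicut_dominant_def by force
qed

lemma convex_multicut_polytope: "convex (multicut_polytope V E S)"
  by (simp add: multicut_polytope_def)

lemma convex_multicut_dominant: "convex (multicut_dominant V E S)"
proof -
  have "multicut_dominant V E S =
      (\<Union>x \<in> multicut_polytope V E S. \<Union>y \<in> nonneg_orthant E. {x + y})"
    by (auto simp: multicut_dominant_def)
  then show ?thesis
    by (simp add: convex_sums convex_multicut_polytope convex_nonneg_orthant)
qed

text \<open>This coordinate subspace stands for the space of real vectors indexed by
  \<open>E\<close>. Its dimension bounds that of both polyhedra from above.\<close>

definition edge_space :: "'v set set \<Rightarrow> (real ^ ('v::finite) set) set" where
  "edge_space E = {x. \<forall>e. e \<notin> E \<longrightarrow> x $ e = 0}"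

lemma subspace_edge_space: "subspace (edge_space E)"
  by (auto simp: subspace_def edge_space_def)

lemma edge_space_subset:
  assumes "subspace U" "\<And>e. e \<in> E \<Longrightarrow> axis e 1 \<in> U"
  shows "edge_space E \<subseteq> U"
proof
  fix x
  assume x: "x \<in> edge_space E"
  have "x = (\<Sum>e \<in> E. x $ e *\<^sub>R axis e 1)"
    using x
    by (auto simp: vec_eq_iff edge_space_def axis_def if_distrib[of "\<lambda>z. _ * z"] cong: if_cong)
  also have "\<dots> \<in> U"
    using assms by (intro subspace_sum subspace_scale) auto
  finally show "x \<in> U" .
qed

lemma multicut_polytope_subset_edge_space: "multicut_polytope V E S \<subseteq> edge_space E"
  unfolding multicut_polytope_def
  by (intro hull_minimal subspace_imp_convex subspace_edge_space)
    (auto simp: edge_space_def incidence_vector_def multicut_def)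

lemma multicut_dominant_subset_edge_space: "multicut_dominant V E S \<subseteq> edge_space E"
  using multicut_polytope_subset_edge_space[of V E S]
  by (fastforce simp: multicut_dominant_def nonneg_orthant_def edge_space_def)

text \<open>One set of witnesses serves both polyhedra: incidence vectors of multicuts lie in the
  polytope, hence in the dominant, and nonnegativity of \<open>f\<close> on the orthant carries
  validity over to the dominant. The spanning hypothesis speaks of an arbitrary subspace
  \<open>U\<close>, so that it can be verified by closure arguments alone.\<close>

lemma defines_shared_facetI:
  fixes f :: "real ^ ('v::finite) set \<Rightarrow> real"
  assumes f: "linear f" "\<And>y. y \<in> nonneg_orthant E \<Longrightarrow> 0 \<le> f y"
    and valid: "\<And>\<delta>. multicut V E S \<delta> \<Longrightarrow> b \<le> f (incidence_vector \<delta>)"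
    and T: "T \<noteq> {}" "\<And>\<delta>. \<delta> \<in> T \<Longrightarrow> multicut V E S \<delta> \<and> f (incidence_vector \<delta>) = b"
    and \<eta>: "multicut V E S \<eta>" "f (incidence_vector \<eta>) \<noteq> b"
    and span: "\<And>U e. subspace U \<Longrightarrow>
      (\<And>\<delta> \<delta>'. \<delta> \<in> insert \<eta> T \<Longrightarrow> \<delta>' \<in> insert \<eta> T \<Longrightarrow> incidence_vector \<delta> - incidence_vector \<delta>' \<in> U)
      \<Longrightarrow> e \<in> E \<Longrightarrow> axis e 1 \<in> U"
  shows "defines_shared_facet f b V E S"
proof -
  define p where "p = (incidence_vector \<eta> :: real ^ 'v set)"
  define X where "X = (incidence_vector ` T :: (real ^ 'v set) set)"
  \<comment> \<open>Translating by \<open>p\<close> turns the affine dimension of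
    \<open>insert p X\<close> into the linear dimension of \<open>?Y\<close>.\<close>
  let ?Y = "(\<lambda>x. - p + x) ` insert p X"
  have "x - y \<in> span ?Y" if "x \<in> insert p X" "y \<in> insert p X" for x y
  proof -
    have "(- p + x) - (- p + y) \<in> span ?Y"
      using that by (intro span_diff span_base imageI)
    then show ?thesis by simp
  qed
  then have "edge_space E \<subseteq> span ?Y"
    by (intro edge_space_subset span subspace_span) (auto simp: p_def X_def)
  then have "dim (edge_space E) \<le> dim ?Y"
    by (metis dim_span dim_subset)
  also have "int (dim ?Y) = aff_dim (insert p X)"
    by (subst aff_dim_eq_dim[of p]) (auto intro: hull_inc)
  finally have dim: "aff_dim (edge_space E) \<le> aff_dim (insert p X)"
    by (simp add: aff_dim_subspace subspace_edge_space)
  have "multicut_polytope V E S \<subseteq> {x. b \<le> f x}"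
    unfolding multicut_polytope_def
  proof (rule hull_minimal)
    have "{x. b \<le> f x} = f -` {b..}" by auto
    then show "convex {x. b \<le> f x}"
      using convex_linear_vimage[OF f(1)] by auto
  qed (use valid in auto)
  then have polytope: "b \<le> f x" if "x \<in> multicut_polytope V E S" for x
    using that by blast
  have dominant: "b \<le> f x" if "x \<in> multicut_dominant V E S" for x
    using that f(2) polytope unfolding multicut_dominant_def
    by (fastforce simp: linear_add[OF f(1)] intro: add_increasing2)
  have cut: "incidence_vector \<delta> \<in> multicut_polytope V E S" if "multicut V E S \<delta>" for \<delta>
    unfolding multicut_polytope_def using that by (blast intro: hull_inc)
  \<comment> \<open>Any convex set between the polytope and the edge space on which the inequality
    is valid will do; polytope and dominant are the two instances.\<close>
  have "facet_defining f b P"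
    if P: "convex P" "multicut_polytope V E S \<subseteq> P" "P \<subseteq> edge_space E"
      "\<And>x. x \<in> P \<Longrightarrow> b \<le> f x" for P
  proof (rule facet_definingI)
    show "X \<subseteq> {x \<in> P. f x = b}" "X \<noteq> {}"
      using T cut P(2) by (auto simp: X_def)
    show "p \<in> P" "f p \<noteq> b"
      using \<eta> cut P(2) by (auto simp: p_def)
    show "aff_dim P \<le> aff_dim (insert p X)"
      using aff_dim_subset[OF P(3)] dim by linarith
  qed (use f P in auto)
  note facet = this
  show ?thesis
    unfolding defines_shared_facet_def
    by (intro conjI facet convex_multicut_dominant multicut_polytope_subset_dominant dominant polytope
      convex_multicut_polytope multicut_polytope_subset_edge_space multicut_dominant_subset_edge_space
      order_refl)
qed

section \<open>Multicuts of the tree\<close>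

text \<open>Ordered pairs allow both kinds of leaves to be treated alike. Each unordered pair occurs
  twice, so the counts below are doubled instead of involving binomial coefficients.\<close>

definition arcs :: "'a set \<Rightarrow> ('a \<times> 'a) set" where
  "arcs B = {(i, j) \<in> B \<times> B. i \<noteq> j}"

lemma finite_arcs: "finite B \<Longrightarrow> finite (arcs B)"
  by (rule finite_subset[of _ "B \<times> B"]) (auto simp: arcs_def)

lemma card_arcs:
  assumes "finite B"
  shows "real (card (arcs B)) = real (card B) * (real (card B) - 1)"
proof -
  have "arcs B = Sigma B (\<lambda>i. B - {i})"
    by (auto simp: arcs_def)
  then have "card (arcs B) = (\<Sum>i \<in> B. card B - 1)"
    using assms by simp
  then show ?thesis
    by (cases "card B") (auto simp: algebra_simps)
qed

lemma sum_arcs_swap: "(\<Sum>(i, j) \<in> arcs B. h j i) = (\<Sum>(i, j) \<in> arcs B. h i j)"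
  by (rule sum.reindex_bij_witness[of _ prod.swap prod.swap]) (auto simp: arcs_def)

text \<open>This lets a level 2 sum be estimated pair by pair, through the joint contribution of the
  two edges that belong to one terminal pair.\<close>

lemma sum_arcs_symmetrize:
  fixes h :: "'a \<Rightarrow> 'a \<Rightarrow> real"
  shows "2 * (\<Sum>(i, j) \<in> arcs B. h i j) = (\<Sum>(i, j) \<in> arcs B. h i j + h j i)"
  using sum_arcs_swap[of h B] by (simp add: sum.distrib case_prod_unfold)

text \<open>
  Writing \<open>leaf i j\<close> for \<open>s i j\<close> if \<open>i < j\<close> and for \<open>t j i\<close> if \<open>j < i\<close> indexes the leaves, and the
  level 2 edges, by ordered pairs of distinct indices, with \<open>leaf i j\<close> below \<open>v i\<close>.
\<close>

locale multicut_tree =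
  fixes n :: nat and r :: "'v::finite" and v :: "nat \<Rightarrow> 'v" and s t :: "nat \<Rightarrow> nat \<Rightarrow> 'v"
  assumes distinct: "distinct_nodes n r v s t"
begin

text \<open>Otherwise \<open>{1..n}\<close> becomes \<open>{Suc 0..n}\<close>, and facts about \<open>arcs {1..n}\<close> no longer match.\<close>

declare One_nat_def [simp del]

definition leaf :: "nat \<Rightarrow> nat \<Rightarrow> 'v" where
  "leaf i j = (if i < j then s i j else t j i)"

definition edge1 :: "nat \<Rightarrow> 'v set" where
  "edge1 i = {r, v i}"

definition edge2 :: "nat \<Rightarrow> nat \<Rightarrow> 'v set" where
  "edge2 i j = {v i, leaf i j}"

abbreviation "N \<equiv> {1..n}"
abbreviation "V \<equiv> tree_nodes n r v s t"
abbreviation "E \<equiv> tree_edges n r v s t"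
abbreviation "S \<equiv> terminal_pairs n s t"

section \<open>Distinctness of the nodes\<close>

lemma arcs_N_cases:
  assumes "(i, j) \<in> arcs N"
  obtains "i < j" "(i, j) \<in> index_pairs n" "leaf i j = s i j" "leaf j i = t i j"
    | "j < i" "(j, i) \<in> index_pairs n" "leaf i j = t j i" "leaf j i = s j i"
  using assms by (cases i j rule: linorder_cases) (auto simp: arcs_def index_pairs_def leaf_def)

lemma index_pairs_leaf:
  assumes "(i, j) \<in> index_pairs n"
  shows "(i, j) \<in> arcs N" "(j, i) \<in> arcs N" "s i j = leaf i j" "t i j = leaf j i"
  using assms by (auto simp: arcs_def index_pairs_def leaf_def)

lemma distinct_nodesD:
  "inj_on v N"
  "inj_on (\<lambda>(i, j). s i j) (index_pairs n)"
  "inj_on (\<lambda>(i, j). t i j) (index_pairs n)"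
  "r \<notin> v ` N"
  "r \<notin> (\<lambda>(i, j). s i j) ` index_pairs n"
  "r \<notin> (\<lambda>(i, j). t i j) ` index_pairs n"
  "v ` N \<inter> (\<lambda>(i, j). s i j) ` index_pairs n = {}"
  "v ` N \<inter> (\<lambda>(i, j). t i j) ` index_pairs n = {}"
  "(\<lambda>(i, j). s i j) ` index_pairs n \<inter> (\<lambda>(i, j). t i j) ` index_pairs n = {}"
  using distinct unfolding distinct_nodes_def by blast+

lemma s_in_image: "(i, j) \<in> index_pairs n \<Longrightarrow> s i j \<in> (\<lambda>(i, j). s i j) ` index_pairs n"
  by (rule image_eqI[of _ _ "(i, j)"]) auto

lemma t_in_image: "(i, j) \<in> index_pairs n \<Longrightarrow> t i j \<in> (\<lambda>(i, j). t i j) ` index_pairs n"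
  by (rule image_eqI[of _ _ "(i, j)"]) auto

lemma leaf_in_image:
  assumes "(i, j) \<in> arcs N"
  shows "leaf i j \<in> (\<lambda>(i, j). s i j) ` index_pairs n \<union> (\<lambda>(i, j). t i j) ` index_pairs n"
  using assms by (cases rule: arcs_N_cases) (simp_all add: s_in_image t_in_image)

lemma v_eq_iff: "i \<in> N \<Longrightarrow> j \<in> N \<Longrightarrow> v i = v j \<longleftrightarrow> i = j"
  by (rule inj_on_eq_iff[OF distinct_nodesD(1)])

lemma v_neq_r: "i \<in> N \<Longrightarrow> v i \<noteq> r" "i \<in> N \<Longrightarrow> r \<noteq> v i"
  using distinct_nodesD(4) by blast+

lemma leaf_neq_r: "(i, j) \<in> arcs N \<Longrightarrow> leaf i j \<noteq> r" "(i, j) \<in> arcs N \<Longrightarrow> r \<noteq> leaf i j"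
  using leaf_in_image distinct_nodesD(5,6) by (metis Un_iff)+

lemma leaf_neq_v:
  assumes "(i, j) \<in> arcs N" "l \<in> N"
  shows "leaf i j \<noteq> v l" "v l \<noteq> leaf i j"
proof -
  have "v l \<in> v ` N" using assms by blast
  then show "leaf i j \<noteq> v l" "v l \<noteq> leaf i j"
    using leaf_in_image[OF assms(1)] distinct_nodesD(7,8) by (metis IntI Un_iff empty_iff)+
qed

lemma leaf_eq_iff:
  assumes "(i, j) \<in> arcs N" "(i', j') \<in> arcs N"
  shows "leaf i j = leaf i' j' \<longleftrightarrow> i = i' \<and> j = j'"
proof -
  have s: "s a b = s a' b' \<longleftrightarrow> a = a' \<and> b = b'"
    and t: "t a b = t a' b' \<longleftrightarrow> a = a' \<and> b = b'"
    and st: "s a b \<noteq> t a' b'" "t a' b' \<noteq> s a b"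
    if "(a, b) \<in> index_pairs n" "(a', b') \<in> index_pairs n" for a b a' b'
  proof -
    show "s a b = s a' b' \<longleftrightarrow> a = a' \<and> b = b'"
      using inj_on_eq_iff[OF distinct_nodesD(2) that] by simp
    show "t a b = t a' b' \<longleftrightarrow> a = a' \<and> b = b'"
      using inj_on_eq_iff[OF distinct_nodesD(3) that] by simp
    show "s a b \<noteq> t a' b'" "t a' b' \<noteq> s a b"
      using s_in_image[OF that(1)] t_in_image[OF that(2)] distinct_nodesD(9)
      by (metis IntI empty_iff)+
  qed
  show ?thesis
    using assms(1)
  proof (cases rule: arcs_N_cases)
    case 1
    from assms(2) show ?thesis
      by (cases rule: arcs_N_cases) (use 1 in \<open>auto simp: s st\<close>)
  next
    case 2
    from assms(2) show ?thesis
      by (cases rule: arcs_N_cases) (use 2 in \<open>auto simp: t st\<close>)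
  qed
qed

lemmas node_simps = v_eq_iff v_neq_r leaf_neq_r leaf_neq_v leaf_eq_iff

lemma arcs_N_swap: "(i, j) \<in> arcs N \<longleftrightarrow> (j, i) \<in> arcs N"
  by (auto simp: arcs_def)

lemma arcs_N_D: "(i, j) \<in> arcs N \<Longrightarrow> i \<in> N" "(i, j) \<in> arcs N \<Longrightarrow> j \<in> N"
    "(i, j) \<in> arcs N \<Longrightarrow> i \<noteq> j"
  by (auto simp: arcs_def)

section \<open>Edges and terminal pairs indexed by arcs\<close>

lemma level1_edges_eq: "level1_edges n r v = edge1 ` N"
  by (auto simp: level1_edges_def edge1_def)

lemma level2_edges_eq: "level2_edges n v s t = (\<lambda>(i, j). edge2 i j) ` arcs N"
proof
  show "level2_edges n v s t \<subseteq> (\<lambda>(i, j). edge2 i j) ` arcs N"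
    unfolding level2_edges_def edge2_def using index_pairs_leaf by fastforce
  show "(\<lambda>(i, j). edge2 i j) ` arcs N \<subseteq> level2_edges n v s t"
    unfolding level2_edges_def edge2_def by (auto elim!: arcs_N_cases)
qed

lemma E_eq: "E = edge1 ` N \<union> (\<lambda>(i, j). edge2 i j) ` arcs N"
  by (simp add: tree_edges_def level1_edges_eq level2_edges_eq)

lemma terminal_pairs_eq: "S = (\<lambda>(i, j). {leaf i j, leaf j i}) ` arcs N"
proof
  show "S \<subseteq> (\<lambda>(i, j). {leaf i j, leaf j i}) ` arcs N"
    unfolding terminal_pairs_def using index_pairs_leaf by fastforce
  have st: "{s i j, t i j} \<in> S" if "(i, j) \<in> index_pairs n" for i j
    using that unfolding terminal_pairs_def by blast
  have "{leaf i j, leaf j i} \<in> S" if "(i, j) \<in> arcs N" for i j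
    using that by (cases rule: arcs_N_cases) (simp_all add: st insert_commute[of _ "s j i"])
  then show "(\<lambda>(i, j). {leaf i j, leaf j i}) ` arcs N \<subseteq> S"
    by auto
qed

lemma edge1_in_E: "i \<in> N \<Longrightarrow> edge1 i \<in> E"
  by (simp add: E_eq)

lemma edge2_in_E:
  assumes "(i, j) \<in> arcs N"
  shows "edge2 i j \<in> E"
proof -
  have "edge2 i j \<in> (\<lambda>(i, j). edge2 i j) ` arcs N"
    using assms by (rule rev_image_eqI) simp
  then show ?thesis by (simp add: E_eq)
qed

lemma leaf_in_V: "(i, j) \<in> arcs N \<Longrightarrow> leaf i j \<in> V"
  unfolding tree_nodes_def by (auto elim!: arcs_N_cases)

lemma inj_edge1: "inj_on edge1 N"
  by (auto simp: inj_on_def edge1_def doubleton_eq_iff node_simps)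

lemma edge2_eq_iff:
  assumes "(i, j) \<in> arcs N" "(i', j') \<in> arcs N"
  shows "edge2 i j = edge2 i' j' \<longleftrightarrow> i = i' \<and> j = j'"
  using assms arcs_N_D(1)[OF assms(1)] arcs_N_D(1)[OF assms(2)]
  by (auto simp: edge2_def doubleton_eq_iff node_simps)

lemma inj_edge2: "inj_on (\<lambda>(i, j). edge2 i j) (arcs N)"
  by (auto simp: inj_on_def edge2_eq_iff)

lemma edge1_neq_edge2: "l \<in> N \<Longrightarrow> (i, j) \<in> arcs N \<Longrightarrow> edge1 l \<noteq> edge2 i j"
  by (auto simp: edge1_def edge2_def doubleton_eq_iff node_simps arcs_N_D)

lemma edge1_notin_edge2_image:
  assumes "l \<in> N" "A \<subseteq> arcs N"
  shows "edge1 l \<notin> (\<lambda>(i, j). edge2 i j) ` A"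
proof
  assume "edge1 l \<in> (\<lambda>(i, j). edge2 i j) ` A"
  then obtain i j where "(i, j) \<in> A" "edge1 l = edge2 i j"
    by auto
  then show False
    using assms edge1_neq_edge2 by blast
qed

text \<open>The set of leaves below \<open>v i\<close>, together with \<open>v i\<close>, is separated by \<open>edge1 i\<close> alone.\<close>

lemma separated:
  assumes ij: "(i, j) \<in> arcs N" and cut: "edge1 i \<notin> F \<or> edge2 i j \<notin> F" and F: "F \<subseteq> E"
  shows "(leaf i j, leaf j i) \<notin> {(u, w). {u, w} \<in> F}\<^sup>*"
proof
  assume path: "(leaf i j, leaf j i) \<in> {(u, w). {u, w} \<in> F}\<^sup>*"
  from ij have ji: "(j, i) \<in> arcs N" by (simp add: arcs_N_swap)
  note ij_simps = node_simps ij ji arcs_N_D[OF ij] arcs_N_D(3)[OF ij, symmetric]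
  show False
  proof (cases "edge2 i j \<in> F")
    case False
    \<comment> \<open>The only edge at this leaf is missing from \<open>F\<close>, so the singleton
      is closed under adjacency.\<close>
    have "leaf j i \<in> {leaf i j}"
      using path
    proof (rule rtrancl_closed)
      fix u w
      assume "(u, w) \<in> {(u, w). {u, w} \<in> F}" "u \<in> {leaf i j}"
      with F False have uw: "{leaf i j, w} \<in> E" "{leaf i j, w} \<noteq> edge2 i j"
        by auto
      from uw(1) consider l where "l \<in> N" "{leaf i j, w} = edge1 l"
        | a b where "(a, b) \<in> arcs N" "{leaf i j, w} = edge2 a b"
        by (auto simp: E_eq)
      then show "w \<in> {leaf i j}"
      proof cases
        case 1
        then show ?thesis
          using ij by (auto simp: edge1_def doubleton_eq_iff node_simps)
      next
        case 2
        then have "a = i \<and> b = j"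
          using ij arcs_N_D(1)[OF 2(1)] by (auto simp: edge2_def doubleton_eq_iff node_simps)
        with 2 uw(2) show ?thesis by simp
      qed
    qed simp
    then show False
      by (simp add: ij_simps)
  next
    case True
    \<comment> \<open>As \<open>edge2 i j\<close> is present, \<open>edge1 i\<close> is the missing
      edge, and it is the only edge of the tree that leaves \<open>?X\<close>.\<close>
    let ?X = "insert (v i) (leaf i ` (N - {i}))"
    have XE: thesis
      if "u \<in> ?X" "u = v i \<Longrightarrow> thesis" "\<And>l. (i, l) \<in> arcs N \<Longrightarrow> u = leaf i l \<Longrightarrow> thesis" for u thesis
    proof -
      have "(i, l) \<in> arcs N" if "l \<in> N - {i}" for l
        using that ij by (auto simp: arcs_def)
      then show thesis
        using that by blast
    qed
    have i: "i \<in> N" and j: "j \<in> N - {i}"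
      using ij by (auto simp: arcs_def)
    have "leaf j i \<in> ?X"
      using path
    proof (rule rtrancl_closed)
      show "leaf i j \<in> ?X"
        using j by blast
    next
      fix u w
      assume "(u, w) \<in> {(u, w). {u, w} \<in> F}" and u: "u \<in> ?X"
      with F True cut have uw: "{u, w} \<in> E" "{u, w} \<noteq> edge1 i"
        by auto
      from uw(1) consider l where "l \<in> N" "{u, w} = edge1 l"
        | a b where "(a, b) \<in> arcs N" "{u, w} = edge2 a b"
        by (auto simp: E_eq)
      then show "w \<in> ?X"
      proof cases
        case 1
        then have "u = r \<or> u = v l"
          by (auto simp: edge1_def doubleton_eq_iff)
        then have "l = i"
          by (rule_tac XE[OF u]) (use 1(1) i in \<open>auto simp: node_simps\<close>)
        with 1 uw(2) show ?thesis by simp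
      next
        case 2
        then have "u = v a \<and> w = leaf a b \<or> u = leaf a b \<and> w = v a"
          by (auto simp: edge2_def doubleton_eq_iff)
        moreover from this have "a = i"
          by (rule_tac XE[OF u]) (use 2(1) arcs_N_D(1)[OF 2(1)] i in \<open>auto simp: node_simps\<close>)
        moreover have "b \<in> N - {a}"
          using 2(1) by (auto simp: arcs_def)
        ultimately show ?thesis by auto
      qed
    qed
    then show False
      by (rule XE) (use i ji arcs_N_D(3)[OF ij] in \<open>auto simp: node_simps\<close>)
  qed
qed

text \<open>The four edges are precisely those of the tree path between \<open>leaf i j\<close> and
  \<open>leaf j i\<close>, so a multicut is a set of edges that hits all these paths.\<close>

lemma multicut_iff_hits:
  "multicut V E S \<delta> \<longleftrightarrow> \<delta> \<subseteq> E \<and>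
     (\<forall>(i, j) \<in> arcs N. edge1 i \<in> \<delta> \<or> edge1 j \<in> \<delta> \<or> edge2 i j \<in> \<delta> \<or> edge2 j i \<in> \<delta>)"
proof -
  let ?R = "{(u, w). {u, w} \<in> E - \<delta>}"
  have "(leaf i j, leaf j i) \<notin> ?R\<^sup>* \<longleftrightarrow>
      edge1 i \<in> \<delta> \<or> edge1 j \<in> \<delta> \<or> edge2 i j \<in> \<delta> \<or> edge2 j i \<in> \<delta>" (is "?L \<longleftrightarrow> ?H")
    if ij: "(i, j) \<in> arcs N" for i j
  proof
    from ij have ji: "(j, i) \<in> arcs N" by (simp add: arcs_N_swap)
    have E: "edge1 i \<in> E" "edge1 j \<in> E" "edge2 i j \<in> E" "edge2 j i \<in> E"
      using ij ji by (auto intro: edge1_in_E edge2_in_E arcs_N_D)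
    show ?H if ?L
    proof (rule ccontr)
      assume "\<not> ?H"
      with E have "(leaf i j, v i) \<in> ?R" "(v i, r) \<in> ?R" "(r, v j) \<in> ?R" "(v j, leaf j i) \<in> ?R"
        by (auto simp: edge1_def edge2_def insert_commute)
      then have "(leaf i j, leaf j i) \<in> ?R\<^sup>*"
        by (meson converse_rtrancl_into_rtrancl r_into_rtrancl)
      with that show False by blast
    qed
    show ?L if ?H
    proof -
      \<comment> \<open>\<open>separated\<close> treats only the two edges on the side of the
        starting leaf; symmetry of reachability covers the other side.\<close>
      have "sym ?R"
        by (auto simp: sym_def insert_commute)
      then have "(leaf i j, leaf j i) \<in> ?R\<^sup>* \<longleftrightarrow> (leaf j i, leaf i j) \<in> ?R\<^sup>*"
        by (metis symE sym_rtrancl)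
      then show ?L
        using that separated[OF ij, of "E - \<delta>"] separated[OF ji, of "E - \<delta>"] by blast
    qed
  qed
  then have "(\<forall>(i, j) \<in> arcs N. (leaf i j, leaf j i) \<notin> ?R\<^sup>*) \<longleftrightarrow>
    (\<forall>(i, j) \<in> arcs N. edge1 i \<in> \<delta> \<or> edge1 j \<in> \<delta> \<or> edge2 i j \<in> \<delta> \<or> edge2 j i \<in> \<delta>)"
    by fast
  moreover have "(\<forall>a b. {a, b} \<in> S \<longrightarrow> a \<in> V \<longrightarrow> b \<in> V \<longrightarrow> (a, b) \<notin> ?R\<^sup>*) \<longleftrightarrow>
      (\<forall>(i, j) \<in> arcs N. (leaf i j, leaf j i) \<notin> ?R\<^sup>*)"
  proof (intro iffI allI impI ballI)
    fix ij
    assume *: "\<forall>a b. {a, b} \<in> S \<longrightarrow> a \<in> V \<longrightarrow> b \<in> V \<longrightarrow> (a, b) \<notin> ?R\<^sup>*" and "ij \<in> arcs N"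
    then obtain i j where ij: "ij = (i, j)" "(i, j) \<in> arcs N"
      by (cases ij) auto
    have "{leaf i j, leaf j i} \<in> S"
      unfolding terminal_pairs_eq using ij(2) by (rule rev_image_eqI) simp
    then show "case ij of (i, j) \<Rightarrow> (leaf i j, leaf j i) \<notin> ?R\<^sup>*"
      using * ij leaf_in_V arcs_N_swap by simp
  next
    fix a b
    assume *: "\<forall>(i, j) \<in> arcs N. (leaf i j, leaf j i) \<notin> ?R\<^sup>*" and "{a, b} \<in> S"
    then obtain i j where "(i, j) \<in> arcs N" "{a, b} = {leaf i j, leaf j i}"
      by (auto simp: terminal_pairs_eq)
    moreover from this have "(j, i) \<in> arcs N"
      by (simp add: arcs_N_swap)
    ultimately show "(a, b) \<notin> ?R\<^sup>*"
      using * by (auto simp: doubleton_eq_iff)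
  qed
  ultimately show ?thesis
    unfolding multicut_iff by simp
qed

section \<open>The inequality\<close>

definition lhs :: "nat \<Rightarrow> real ^ 'v set \<Rightarrow> real" where
  "lhs m x = real m * (\<Sum>e \<in> level1_edges n r v. x $ e) + (\<Sum>e \<in> level2_edges n v s t. x $ e)"

lemma linear_lhs: "linear (lhs m)"
  by (rule linearI)
    (simp_all add: lhs_def sum.distrib algebra_simps flip: sum_distrib_left)

lemma lhs_eq:
  "lhs m x = real m * (\<Sum>i \<in> N. x $ edge1 i) + (\<Sum>(i, j) \<in> arcs N. x $ edge2 i j)"
  using inj_edge1 inj_edge2
  by (simp add: lhs_def level1_edges_eq level2_edges_eq sum.reindex case_prod_unfold)

lemma lhs_nonneg: "y \<in> nonneg_orthant E \<Longrightarrow> 0 \<le> lhs m y"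
  by (auto simp: lhs_def nonneg_orthant_def tree_edges_def intro!: add_nonneg_nonneg mult_nonneg_nonneg sum_nonneg)

text \<open>\<open>B\<close> collects the indices left uncut at level 1. Level 1 enters only through
  its size, and the doubled level 2 part groups the two edges of each terminal pair.\<close>

lemma lhs_incidence_vector:
  fixes \<delta> :: "'v set set"
  defines "B \<equiv> {i \<in> N. edge1 i \<notin> \<delta>}"
  defines "h \<equiv> \<lambda>i j. of_bool (edge2 i j \<in> \<delta>) :: real"
  shows "2 * lhs m (incidence_vector \<delta>) =
    2 * real m * (real n - real (card B)) + (\<Sum>(i, j) \<in> arcs N. h i j + h j i)"
proof -
  have "(\<Sum>i \<in> N. incidence_vector \<delta> $ edge1 i :: real) = (\<Sum>i \<in> N - B. 1)"
    by (rule sum.mono_neutral_cong_right) (auto simp: B_def incidence_vector_def)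
  also have "\<dots> = real n - real (card B)"
  proof -
    have "B \<subseteq> N" "finite B"
      by (auto simp: B_def)
    then have "card (N - B) = n - card B" "card B \<le> n"
      using card_mono[of N B] by (simp_all add: card_Diff_subset)
    then show ?thesis
      by (simp add: of_nat_diff)
  qed
  finally have "lhs m (incidence_vector \<delta>) =
      real m * (real n - real (card B)) + (\<Sum>(i, j) \<in> arcs N. h i j)"
    by (simp add: lhs_eq h_def incidence_vector_def of_bool_def)
  then show ?thesis
    using sum_arcs_symmetrize[of h N] by (simp add: algebra_simps)
qed

text \<open>With \<open>B\<close> the set of indices uncut at level 1, every pair inside
  \<open>B\<close> still has to be separated at level 2; the relation \<open>R\<close> selects the
  edge that does so.\<close>

definition oriented_cut :: "nat set \<Rightarrow> (nat \<Rightarrow> nat \<Rightarrow> bool) \<Rightarrow> 'v set set" where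
  "oriented_cut B R = edge1 ` (N - B) \<union> (\<lambda>(i, j). edge2 i j) ` {(i, j) \<in> arcs B. R i j}"

text \<open>Exactly one direction per pair: at least one makes the oriented cut a multicut, at most
  one keeps it tight at level 2.\<close>

definition tournament :: "(nat \<Rightarrow> nat \<Rightarrow> bool) \<Rightarrow> bool" where
  "tournament R \<longleftrightarrow> (\<forall>i j. i \<noteq> j \<longrightarrow> R i j \<noteq> R j i)"

lemma oriented_arcs_subset: "B \<subseteq> N \<Longrightarrow> {(i, j) \<in> arcs B. R i j} \<subseteq> arcs N"
  by (auto simp: arcs_def)

lemma edge1_in_oriented_cut:
  assumes "i \<in> N" "B \<subseteq> N"
  shows "edge1 i \<in> oriented_cut B R \<longleftrightarrow> i \<notin> B"
  using inj_on_image_mem_iff[OF inj_edge1 assms(1), of "N - B"] assms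
    edge1_notin_edge2_image[OF assms(1) oriented_arcs_subset[OF assms(2), of R]]
  by (simp add: oriented_cut_def)

lemma edge2_in_oriented_cut:
  assumes "(i, j) \<in> arcs N" "B \<subseteq> N"
  shows "edge2 i j \<in> oriented_cut B R \<longleftrightarrow> (i, j) \<in> arcs B \<and> R i j"
proof -
  have "edge2 i j \<notin> edge1 ` (N - B)"
    using edge1_neq_edge2[OF _ assms(1)] by fastforce
  then show ?thesis
    using inj_on_image_mem_iff[OF inj_edge2 assms(1) oriented_arcs_subset[OF assms(2), of R]]
    by (simp add: oriented_cut_def)
qed

lemma oriented_cut_subset:
  assumes "B \<subseteq> N"
  shows "oriented_cut B R \<subseteq> E"
  unfolding oriented_cut_def E_eq
  by (intro Un_mono image_mono oriented_arcs_subset assms) auto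

lemma multicut_oriented_cut:
  assumes B: "B \<subseteq> N" and R: "tournament R"
  shows "multicut V E S (oriented_cut B R)"
proof -
  let ?\<delta> = "oriented_cut B R"
  have "edge1 i \<in> ?\<delta> \<or> edge1 j \<in> ?\<delta> \<or> edge2 i j \<in> ?\<delta> \<or> edge2 j i \<in> ?\<delta>"
    if ij: "(i, j) \<in> arcs N" for i j
  proof (cases "i \<in> B \<and> j \<in> B")
    case False
    then show ?thesis
      using edge1_in_oriented_cut[OF _ B] arcs_N_D[OF ij] by blast
  next
    case True
    then have "(i, j) \<in> arcs B" "(j, i) \<in> arcs B" and ji: "(j, i) \<in> arcs N"
      using ij by (auto simp: arcs_def)
    moreover have "R i j \<or> R j i"
      using R arcs_N_D(3)[OF ij] unfolding tournament_def by blast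
    ultimately show ?thesis
      using edge2_in_oriented_cut[OF ij B] edge2_in_oriented_cut[OF ji B] by blast
  qed
  then have "\<forall>(i, j) \<in> arcs N. edge1 i \<in> ?\<delta> \<or> edge1 j \<in> ?\<delta> \<or> edge2 i j \<in> ?\<delta> \<or> edge2 j i \<in> ?\<delta>"
    by fast
  then show ?thesis
    using oriented_cut_subset[OF B] by (simp add: multicut_iff_hits)
qed

text \<open>In this form the difference of two cuts collapses to the few unit vectors in which they
  differ.\<close>

lemma incidence_vector_oriented_cut:
  assumes "B \<subseteq> N"
  shows "incidence_vector (oriented_cut B R) =
    (\<Sum>i \<in> N - B. axis (edge1 i) 1) + (\<Sum>(i, j) \<in> {(i, j) \<in> arcs B. R i j}. axis (edge2 i j) 1)"
proof -
  have sub: "{(i, j) \<in> arcs B. R i j} \<subseteq> arcs N"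
    by (rule oriented_arcs_subset[OF assms])
  then have "finite {(i, j) \<in> arcs B. R i j}"
    by (rule finite_subset) (simp add: finite_arcs)
  moreover have "edge1 ` (N - B) \<inter> (\<lambda>(i, j). edge2 i j) ` {(i, j) \<in> arcs B. R i j} = {}"
  proof (rule equals0I, elim IntE imageE[of _ edge1])
    fix e l
    assume "e = edge1 l" "l \<in> N - B" "e \<in> (\<lambda>(i, j). edge2 i j) ` {(i, j) \<in> arcs B. R i j}"
    then show False
      using edge1_notin_edge2_image[OF _ sub, of l] by simp
  qed
  ultimately show ?thesis
    unfolding incidence_vector_eq_sum oriented_cut_def
    using inj_on_subset[OF inj_edge1, of "N - B"] inj_on_subset[OF inj_edge2 sub]
    by (simp add: sum.union_disjoint sum.reindex case_prod_unfold)
qed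

end

text \<open>The parameter \<open>m\<close> is the level 1 coefficient \<open>n - k\<close>; the
  equation \<open>n = m + k\<close> keeps truncated subtraction out of the calculations.\<close>

locale multicut_tree_inequality = multicut_tree n r v s t
  for n :: nat and r :: "'v::finite" and v :: "nat \<Rightarrow> 'v" and s t :: "nat \<Rightarrow> nat \<Rightarrow> 'v" +
  fixes k m :: nat
  assumes k: "2 \<le> k" and n: "n = m + k" and m: "1 \<le> m"
begin

section \<open>Validity of the inequality\<close>

abbreviation "rhs \<equiv> real (k * m + (m choose 2))"

lemma rhs_eq: "2 * rhs = 2 * real k * real m + real m * (real m - 1)"
proof -
  \<comment> \<open>Evenness makes the natural number quotient in the binomial coefficient agree
    with the real one.\<close>
  have "even (m * (m - 1))" by (cases m) auto
  then have "2 * real (m choose 2) = real (m * (m - 1))"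
    by (simp add: choose_two real_of_nat_div)
  then show ?thesis
    using m by (simp add: of_nat_diff)
qed

text \<open>With \<open>b\<close> uncut level 1 edges, twice the slack factors into two consecutive
  terms: it is nonnegative for every integer \<open>b\<close> and vanishes only at \<open>m\<close>
  and \<open>m + 1\<close>.\<close>

lemma slack_eq:
  fixes b :: real
  shows "2 * real m * (real n - b) + b * (b - 1) - 2 * rhs = (b - m) * (b - m - 1)"
  unfolding rhs_eq by (simp add: n algebra_simps)

lemma rhs_le_lhs:
  assumes "multicut V E S \<delta>"
  shows "rhs \<le> lhs m (incidence_vector \<delta>)"
proof -
  define B where "B = {i \<in> N. edge1 i \<notin> \<delta>}"
  define h where "h = (\<lambda>i j. of_bool (edge2 i j \<in> \<delta>) :: real)"
  have "real (card B) * (real (card B) - 1) = (\<Sum>(i, j) \<in> arcs B. 1)"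
    using card_arcs[of B] by (simp add: B_def)
  \<comment> \<open>Neither index of such a pair is cut at level 1, so one of its two level 2 edges
    must be.\<close>
  also have "\<dots> \<le> (\<Sum>(i, j) \<in> arcs B. h i j + h j i)"
  proof (rule sum_mono, clarify)
    fix i j assume "(i, j) \<in> arcs B"
    then have "(i, j) \<in> arcs N" "edge1 i \<notin> \<delta>" "edge1 j \<notin> \<delta>"
      by (auto simp: arcs_def B_def)
    then show "1 \<le> h i j + h j i"
      using assms by (auto simp: multicut_iff_hits h_def)
  qed
  also have "\<dots> \<le> (\<Sum>(i, j) \<in> arcs N. h i j + h j i)"
  proof (rule sum_mono2)
    show "finite (arcs N)" by (simp add: finite_arcs)
    show "arcs B \<subseteq> arcs N" by (auto simp: arcs_def B_def)
  qed (auto simp: h_def)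
  finally have "2 * real m * (real n - card B) + real (card B) * (real (card B) - 1) \<le>
      2 * lhs m (incidence_vector \<delta>)"
    using lhs_incidence_vector[of m \<delta>, folded B_def] by (simp add: h_def)
  \<comment> \<open>Integrality of \<open>card B\<close> matters here: strictly between
    \<open>m\<close> and \<open>m + 1\<close> the product is negative.\<close>
  moreover have "0 \<le> (real (card B) - m) * (real (card B) - m - 1)"
  proof (cases "card B \<le> m")
    case False
    then have "real (card B) \<ge> m + 1" by linarith
    then show ?thesis by simp
  qed (simp add: mult_nonpos_nonpos)
  then have "2 * rhs \<le> 2 * real m * (real n - card B) + real (card B) * (real (card B) - 1)"
    using slack_eq[of "card B"] by (metis diff_ge_0_iff_ge)
  ultimately have "2 * rhs \<le> 2 * lhs m (incidence_vector \<delta>)"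
    by (rule order_trans[rotated])
  then show ?thesis by simp
qed

definition tight_cuts :: "'v set set set" where
  "tight_cuts = {oriented_cut B R |B R. B \<subseteq> N \<and> card B \<in> {m, Suc m} \<and> tournament R}"

text \<open>Every estimate in \<open>rhs_le_lhs\<close> is an equality here: each pair inside
  \<open>B\<close> is cut once at level 2, no level 2 edge is cut elsewhere, and the size of
  \<open>B\<close> makes the slack vanish.\<close>

lemma lhs_tight_cut:
  assumes "B \<subseteq> N" "card B \<in> {m, Suc m}" "tournament R"
  shows "lhs m (incidence_vector (oriented_cut B R)) = rhs"
proof -
  have B: "{i \<in> N. edge1 i \<notin> oriented_cut B R} = B"
    using assms edge1_in_oriented_cut by blast
  define h where "h = (\<lambda>i j. of_bool (edge2 i j \<in> oriented_cut B R) :: real)"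
  have sub: "arcs B \<subseteq> arcs N"
    using assms(1) by (auto simp: arcs_def)
  have h: "h i j + h j i = of_bool ((i, j) \<in> arcs B)" if ij: "(i, j) \<in> arcs N" for i j
  proof -
    have ji: "(j, i) \<in> arcs N"
      using ij by (simp add: arcs_N_swap)
    have "(j, i) \<in> arcs B \<longleftrightarrow> (i, j) \<in> arcs B"
      by (auto simp: arcs_def)
    moreover have "R j i \<longleftrightarrow> \<not> R i j"
      using assms(3) arcs_N_D(3)[OF ij] unfolding tournament_def by blast
    ultimately show ?thesis
      using edge2_in_oriented_cut[OF ij assms(1)] edge2_in_oriented_cut[OF ji assms(1)]
      by (simp add: h_def)
  qed
  have "(\<Sum>(i, j) \<in> arcs N. h i j + h j i) = (\<Sum>(i, j) \<in> arcs B. 1)"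
    using sub by (intro sum.mono_neutral_cong_right) (auto simp: finite_arcs h subset_iff)
  also have "\<dots> = real (card B) * (real (card B) - 1)"
    using card_arcs[of B] assms(1) finite_subset by auto
  finally have "2 * lhs m (incidence_vector (oriented_cut B R)) =
      2 * real m * (real n - card B) + real (card B) * (real (card B) - 1)"
    using lhs_incidence_vector[of m "oriented_cut B R", unfolded B] by (simp add: h_def)
  moreover have "(real (card B) - m) * (real (card B) - m - 1) = 0"
    using assms(2) by auto
  then have "2 * real m * (real n - card B) + real (card B) * (real (card B) - 1) = 2 * rhs"
    using slack_eq[of "card B"] by (metis right_minus_eq)
  ultimately have "2 * lhs m (incidence_vector (oriented_cut B R)) = 2 * rhs"
    by (rule trans)
  then show ?thesis by simp
qed

text \<open>
  A multicut off the face, chosen to differ from a tight one by a single unit vector.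
\<close>

definition extra_cut :: "'v set set" where
  "extra_cut = insert (edge2 2 1) (oriented_cut {1..Suc m} (<))"

lemma tournament_less: "tournament (<)"
  by (auto simp: tournament_def)

lemma base_cut: "oriented_cut {1..Suc m} (<) \<in> tight_cuts"
  unfolding tight_cuts_def using tournament_less k n by fastforce

lemma arcs_21: "(2, 1) \<in> arcs N"
  using k n m by (simp add: arcs_def)

lemma extra_cut_eq:
  "incidence_vector extra_cut = axis (edge2 2 1) 1 + incidence_vector (oriented_cut {1..Suc m} (<))"
proof -
  \<comment> \<open>The relation \<open><\<close> selects \<open>edge2 1 2\<close> for this pair, so
    its partner is new.\<close>
  have "edge2 2 1 \<notin> oriented_cut {1..Suc m} (<)"
    using edge2_in_oriented_cut[OF arcs_21] k n by auto
  then show ?thesis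
    by (simp add: extra_cut_def incidence_vector_eq_sum)
qed

lemma multicut_extra_cut: "multicut V E S extra_cut"
proof -
  have "multicut V E S (oriented_cut {1..Suc m} (<))"
    using k n by (intro multicut_oriented_cut tournament_less) auto
  moreover have "edge2 2 1 \<in> E"
    using arcs_21 by (rule edge2_in_E)
  ultimately show ?thesis
    by (auto simp: multicut_iff_hits extra_cut_def)
qed

lemma lhs_extra_cut: "lhs m (incidence_vector extra_cut) = rhs + 1"
proof -
  have "edge2 2 1 \<notin> level1_edges n r v"
    using edge1_neq_edge2[OF _ arcs_21] by (fastforce simp: level1_edges_eq)
  moreover have "edge2 2 1 \<in> level2_edges n v s t"
    unfolding level2_edges_eq using arcs_21 by (rule rev_image_eqI) simp
  ultimately have "lhs m (axis (edge2 2 1) 1) = 1"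
    by (simp add: lhs_def axis_def)
  moreover have "lhs m (incidence_vector (oriented_cut {1..Suc m} (<))) = rhs"
    using k n by (intro lhs_tight_cut tournament_less) auto
  ultimately show ?thesis
    by (simp add: extra_cut_eq linear_add[OF linear_lhs])
qed

text \<open>This supplies the filler indices that bring an index set to one of the two tight
  sizes.\<close>

lemma obtain_indices:
  assumes "A \<subseteq> N" "c + card A \<le> n"
  obtains C where "C \<subseteq> N - A" "card C = c" "finite C"
proof -
  have "finite A"
    using assms(1) by (rule finite_subset) simp
  then have "card (N - A) = n - card A"
    using assms(1) by (simp add: card_Diff_subset)
  then have "c \<le> card (N - A)"
    using assms(2) by simp
  then obtain C where "C \<subseteq> N - A" "card C = c" "finite C"
    by (rule obtain_subset_with_card_n)
  then show thesis by (rule that)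
qed

section \<open>Unit vectors spanned by differences of multicuts\<close>

context
  fixes U :: "(real ^ 'v set) set"
  assumes U: "subspace U"
    and diff: "\<And>\<delta> \<delta>'. \<delta> \<in> insert extra_cut tight_cuts \<Longrightarrow> \<delta>' \<in> insert extra_cut tight_cuts \<Longrightarrow>
      incidence_vector \<delta> - incidence_vector \<delta>' \<in> U"
begin

text \<open>Two tournaments on the same \<open>B\<close> of size \<open>m + 1\<close> that differ
  only on the pair \<open>{i, j}\<close> give tight cuts that differ only in these two
  edges.\<close>

lemma flip_mem:
  assumes "(i, j) \<in> arcs N"
  shows "axis (edge2 i j) 1 - axis (edge2 j i) 1 \<in> U"
proof -
  have "i \<noteq> j" "i \<in> N" "j \<in> N"
    using assms by (auto simp: arcs_def)
  \<comment> \<open>With \<open>i\<close> and \<open>j\<close>, the \<open>m - 1\<close> fillers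
    make up a set of size \<open>Suc m\<close>.\<close>
  then have "{i, j} \<subseteq> N" "m - 1 + card {i, j} \<le> n"
    using k n by auto
  then obtain C where C: "C \<subseteq> N - {i, j}" "card C = m - 1" and fin: "finite C"
    by (rule obtain_indices)
  define B where "B = insert i (insert j C)"
  have "i \<notin> C" "j \<notin> C" using C(1) by auto
  then have "card B = Suc m"
    using \<open>i \<noteq> j\<close> C(2) fin m by (simp add: B_def)
  have B: "B \<subseteq> N" using C(1) \<open>{i, j} \<subseteq> N\<close> by (auto simp: B_def)
  have fB: "finite (arcs B)" using fin by (auto simp: B_def intro: finite_arcs)
  define Q where "Q a b \<longleftrightarrow> (if {a, b} = {i, j} then a = i else a < b)" for a b
  define Q' where "Q' a b \<longleftrightarrow> (if {a, b} = {i, j} then a = j else a < b)" for a b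
  have "tournament Q" "tournament Q'"
    using \<open>i \<noteq> j\<close> unfolding tournament_def Q_def Q'_def by (auto simp: doubleton_eq_iff)
  then have "oriented_cut B Q \<in> tight_cuts" "oriented_cut B Q' \<in> tight_cuts"
    unfolding tight_cuts_def using B \<open>card B = Suc m\<close> by blast+
  then have "incidence_vector (oriented_cut B Q) - incidence_vector (oriented_cut B Q') \<in> U"
    by (intro diff) auto
  moreover define D where "D = {(a, b) \<in> arcs B. {a, b} \<noteq> {i, j} \<and> a < b}"
  have "{(a, b) \<in> arcs B. Q a b} = insert (i, j) D" "{(a, b) \<in> arcs B. Q' a b} = insert (j, i) D"
    using \<open>i \<noteq> j\<close> by (auto simp: Q_def Q'_def D_def arcs_def B_def doubleton_eq_iff split: if_splits)
  moreover have "finite D" "(i, j) \<notin> D" "(j, i) \<notin> D"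
    using fB by (auto simp: D_def intro: finite_subset[OF _ fB])
  ultimately show ?thesis
    by (simp add: incidence_vector_oriented_cut[OF B])
qed

text \<open>Passing from \<open>B\<close> to \<open>insert i B\<close> moves between the two tight
  sizes. It uncuts \<open>edge1 i\<close> and, if \<open>i\<close> beats all of \<open>B\<close>,
  pays with exactly the edges \<open>edge2 i j\<close> for \<open>j\<close> in
  \<open>B\<close>.\<close>

lemma star_mem:
  assumes i: "i \<in> N" and B: "B \<subseteq> N - {i}" "card B = m"
  shows "(\<Sum>j \<in> B. axis (edge2 i j) 1) - axis (edge1 i) 1 \<in> U"
proof -
  have fin: "finite B" using B(1) by (rule finite_subset) simp
  \<comment> \<open>The index \<open>i\<close> beats all others, which are ordered by
    \<open><\<close> among themselves.\<close>
  define Q where "Q a b \<longleftrightarrow> a = i \<or> b \<noteq> i \<and> a < b" for a b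
  have "tournament Q"
    by (auto simp: tournament_def Q_def)
  have sub: "insert i B \<subseteq> N" "B \<subseteq> N" and nin: "i \<notin> B" using i B by auto
  have "oriented_cut (insert i B) Q \<in> tight_cuts" "oriented_cut B Q \<in> tight_cuts"
    unfolding tight_cuts_def using \<open>tournament Q\<close> sub nin fin B(2) by fastforce+
  then have "incidence_vector (oriented_cut (insert i B) Q) - incidence_vector (oriented_cut B Q) \<in> U"
    by (intro diff) auto
  moreover
  let ?D = "{(a, b) \<in> arcs B. Q a b}"
  have D: "{(a, b) \<in> arcs (insert i B). Q a b} = Pair i ` B \<union> ?D" "Pair i ` B \<inter> ?D = {}"
    using nin by (auto simp: Q_def arcs_def)
  have "finite ?D"
    by (rule finite_subset[OF _ finite_arcs[OF fin]]) auto
  then have "(\<Sum>(a, b) \<in> {(a, b) \<in> arcs (insert i B). Q a b}. axis (edge2 a b) 1) =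
      (\<Sum>j \<in> B. axis (edge2 i j) (1::real)) + (\<Sum>(a, b) \<in> ?D. axis (edge2 a b) 1)"
    unfolding D(1) using D(2) fin by (simp add: sum.union_disjoint sum.reindex inj_on_def)
  moreover have NB: "N - B = insert i (N - insert i B)"
    using i nin by auto
  have "(\<Sum>j \<in> N - B. axis (edge1 j) 1) =
      axis (edge1 i) (1::real) + (\<Sum>j \<in> N - insert i B. axis (edge1 j) 1)"
    unfolding NB by (rule sum.insert) auto
  ultimately show ?thesis
    by (simp add: incidence_vector_oriented_cut[OF sub(1)] incidence_vector_oriented_cut[OF sub(2)])
qed

text \<open>Two stars at \<open>i\<close> over sets that share all but one index are subtracted:
  \<open>edge1 i\<close> and the common part cancel.\<close>

lemma exchange_mem:
  assumes "(i, j) \<in> arcs N" "(i, l) \<in> arcs N"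
  shows "axis (edge2 i j) 1 - axis (edge2 i l) 1 \<in> U"
proof (cases "j = l")
  case False
  have "card {i, j, l} = 3" "{i, j, l} \<subseteq> N"
    using False assms by (auto simp: arcs_def)
  \<comment> \<open>Here \<open>k \<ge> 2\<close> is decisive: the exchange needs
    \<open>m + 2\<close> indices in all.\<close>
  moreover have "m - 1 + 3 \<le> n"
    using k n m by linarith
  ultimately obtain C where C: "C \<subseteq> N - {i, j, l}" "card C = m - 1" and fin: "finite C"
    using obtain_indices[of "{i, j, l}" "m - 1"] by metis
  have i: "i \<in> N" using assms by (simp add: arcs_def)
  have "j \<notin> C" "l \<notin> C" using C by auto
  then have card: "card (insert j C) = m" "card (insert l C) = m"
    using C(2) fin m by auto
  have "insert j C \<subseteq> N - {i}" "insert l C \<subseteq> N - {i}"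
    using C assms by (auto simp: arcs_def)
  from subspace_diff[OF U star_mem[OF i this(1) card(1)] star_mem[OF i this(2) card(2)]]
  show ?thesis
    using \<open>j \<notin> C\<close> \<open>l \<notin> C\<close> fin by simp
qed (simp add: subspace_0[OF U])

text \<open>Starting from the arc from 2 to 1, exchanges reach all arcs out of 2; a flip then leads
  to the arc from \<open>i\<close> to 2, and one more exchange to the arc from \<open>i\<close> to
  \<open>j\<close>.\<close>

lemma edge2_mem:
  assumes ij: "(i, j) \<in> arcs N"
  shows "axis (edge2 i j) 1 \<in> U"
proof -
  have trans: "axis (edge2 a b) 1 \<in> U"
    if "axis (edge2 c d) 1 \<in> U" "axis (edge2 a b) 1 - axis (edge2 c d) 1 \<in> U" for a b c d
    using subspace_add[OF U that] by simp
  have ex: "axis (edge2 a b) 1 \<in> U"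
    if "axis (edge2 a c) 1 \<in> U" "(a, b) \<in> arcs N" "(a, c) \<in> arcs N" for a b c
    using that exchange_mem trans by blast
  have flip: "axis (edge2 a b) 1 \<in> U" if "axis (edge2 b a) 1 \<in> U" "(a, b) \<in> arcs N" for a b
    using that flip_mem trans by blast
  \<comment> \<open>This is where the cut off the face enters: the vector is its difference from a
    tight cut.\<close>
  have "axis (edge2 2 1) 1 \<in> U"
    using diff[of extra_cut "oriented_cut {1..Suc m} (<)"] base_cut by (simp add: extra_cut_eq)
  then have two: "axis (edge2 2 b) 1 \<in> U" if "(2, b) \<in> arcs N" for b
    using that arcs_21 ex by blast
  show ?thesis
  proof (cases "i = 2")
    case True
    then show ?thesis using two ij by blast
  next
    case False
    then have "(i, 2) \<in> arcs N" "(2, i) \<in> arcs N"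
      using ij arcs_21 by (auto simp: arcs_def)
    then show ?thesis
      using ij two flip ex by blast
  qed
qed

text \<open>The level 2 part of a star at \<open>i\<close> already lies in \<open>U\<close>, so what
  remains of the star is the level 1 unit vector.\<close>

lemma edge1_mem:
  assumes i: "i \<in> N"
  shows "axis (edge1 i) 1 \<in> U"
proof -
  have "{i} \<subseteq> N" "m + card {i} \<le> n"
    using i k n by auto
  then obtain B where B: "B \<subseteq> N - {i}" "card B = m"
    by (rule obtain_indices)
  have "(\<Sum>j \<in> B. axis (edge2 i j) 1) \<in> U"
    using B i by (intro subspace_sum[OF U] edge2_mem) (auto simp: arcs_def)
  from subspace_diff[OF U this star_mem[OF i B]] show ?thesis
    by simp
qed

lemma edge_mem: "e \<in> E \<Longrightarrow> axis e 1 \<in> U"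
  using edge1_mem edge2_mem by (auto simp: E_eq)

end

lemma shared_facet: "defines_shared_facet (lhs m) rhs V E S"
proof (rule defines_shared_facetI[where T = tight_cuts and \<eta> = extra_cut])
  show "tight_cuts \<noteq> {}"
    using base_cut by blast
  show "multicut V E S \<delta> \<and> lhs m (incidence_vector \<delta>) = rhs" if "\<delta> \<in> tight_cuts" for \<delta>
    using that multicut_oriented_cut lhs_tight_cut unfolding tight_cuts_def by blast
  show "lhs m (incidence_vector extra_cut) \<noteq> rhs"
    by (simp add: lhs_extra_cut)
  show "axis e 1 \<in> U"
    if "subspace U" "e \<in> E" "\<And>\<delta> \<delta>'. \<delta> \<in> insert extra_cut tight_cuts \<Longrightarrow>
      \<delta>' \<in> insert extra_cut tight_cuts \<Longrightarrow> incidence_vector \<delta> - incidence_vector \<delta>' \<in> U" for U e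
    using edge_mem[OF that(1,3,2)] .
qed (fact linear_lhs lhs_nonneg rhs_le_lhs multicut_extra_cut)+

end

theorem theorem6p1:
  fixes n k :: nat
    and r :: "'v::finite" and v :: "nat \<Rightarrow> 'v" and s t :: "nat \<Rightarrow> nat \<Rightarrow> 'v"
  assumes "2 \<le> k" and "k < n"
    and "distinct_nodes n r v s t"
  shows "defines_shared_facet
           (\<lambda>x. real (n - k) * (\<Sum>e \<in> level1_edges n r v. x $ e)
                + (\<Sum>e \<in> level2_edges n v s t. x $ e))
           (real (k * (n - k) + ((n - k) choose 2)))
           (tree_nodes n r v s t) (tree_edges n r v s t) (terminal_pairs n s t)"
proof -
  \<comment> \<open>The hypothesis \<open>k < n\<close> makes \<open>n - k\<close> a genuine
    difference and at least 1.\<close>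
  interpret multicut_tree_inequality n r v s t k "n - k"
    using assms by unfold_locales auto
  show ?thesis
    using shared_facet unfolding lhs_def .
qed

end
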